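(* Let $G$ be a connected simple graph on $n\geq 1$ vertices. Then $$\mathrm{gpn}(G)\leq\frac{n}{4}\left(23\cdot 3^{\frac{n-6}{3}}+1\right).$$
   Context: All graphs are finite, simple and connected. A geodesic between vertices $u$ and $v$ of a graph $G$ is a shortest path connecting $u$ and $v$. For distinct $u,v\in V(G)$, $\mathrm{gpn}_G(u,v)$ denotes the number of shortest $u$–$v$ paths in $G$. The geodesic subpath number of a graph $G$ on $n$ vertices is $\mathrm{gpn}(G)=\sum_{\{u,v\}\subseteq V(G),\,u\neq v}\mathrm{gpn}_G(u,v)+n$ (the sum is over unordered pairs of distinct vertices; the term $n$ counts the geodesics of length zero). The exponent $\frac{n-6}{3}$ is a real number, not rounded. *)

theory Defs
  imports Complex_Main "Graph_Theory.Graph_Theory"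
begin

(* Finite simple graphs are the locale graph of Graph_Theory: finite symmetric digraphs without
   loops and parallel arcs, where an undirected edge is a pair of opposite arcs. A path is a list
   of distinct vertices (vpath), so a path between u and v, read from u, is exactly one list. *)

definition paths_between :: "('a, 'b) pre_digraph \<Rightarrow> 'a \<Rightarrow> 'a \<Rightarrow> 'a list set" where
  "paths_between G u v = {p. vpath p G \<and> hd p = u \<and> last p = v}"

definition geodesics :: "('a, 'b) pre_digraph \<Rightarrow> 'a \<Rightarrow> 'a \<Rightarrow> 'a list set" where
  "geodesics G u v =
     {p \<in> paths_between G u v. \<forall>q \<in> paths_between G u v. vwalk_length p \<le> vwalk_length q}"

definition gpn_between :: "('a, 'b) pre_digraph \<Rightarrow> 'a \<Rightarrow> 'a \<Rightarrow> nat" where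
  "gpn_between G u v = card (geodesics G u v)"

(* gpn_between as a function of the unordered pair e = {u, v}. The description is proper because
   gpn_between is symmetric in u and v: see gpn_pair_eq below. *)
definition gpn_pair :: "('a, 'b) pre_digraph \<Rightarrow> 'a set \<Rightarrow> nat" where
  "gpn_pair G e = (THE k. \<exists>u v. e = {u, v} \<and> k = gpn_between G u v)"

definition gpn :: "('a, 'b) pre_digraph \<Rightarrow> nat" where
  "gpn G = (\<Sum>e | e \<subseteq> verts G \<and> card e = 2. gpn_pair G e) + card (verts G)"

context sym_digraph
begin

lemma rev_paths_between:
  assumes "p \<in> paths_between G u v"
  shows "rev p \<in> paths_between G v u"
proof -
  have p: "vwalk p G" "distinct p" "hd p = u" "last p = v"
    using assms by (auto simp: paths_between_def vpath_def)
  have "p \<noteq> []" using p(1) by (simp add: vwalk_def)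
  moreover have "vwalk (rev p) G" using sym_arcs p(1) by (rule vwalk_rev_ex)
  ultimately show ?thesis
    using p by (simp add: paths_between_def vpath_def hd_rev last_rev)
qed

lemma rev_geodesics:
  assumes "p \<in> geodesics G u v"
  shows "rev p \<in> geodesics G v u"
  unfolding geodesics_def
proof (intro CollectI conjI ballI)
  show "rev p \<in> paths_between G v u"
    using assms rev_paths_between by (auto simp: geodesics_def)
next
  fix q assume "q \<in> paths_between G v u"
  then have "vwalk_length p \<le> vwalk_length (rev q)"
    using assms rev_paths_between by (auto simp: geodesics_def simp del: vwalk_length_simp)
  then show "vwalk_length (rev p) \<le> vwalk_length q" by simp
qed

lemma gpn_between_commute: "gpn_between G u v = gpn_between G v u"
proof -
  have "bij_betw rev (geodesics G u v) (geodesics G v u)"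
    by (rule bij_betwI[where g = rev]) (auto simp: rev_geodesics)
  then show ?thesis
    by (simp add: gpn_between_def bij_betw_same_card)
qed

lemma gpn_pair_eq: "gpn_pair G {u, v} = gpn_between G u v"
  unfolding gpn_pair_def
  by (rule the_equality) (auto simp: doubleton_eq_iff gpn_between_commute)

end

end

theory Submission
  imports Defs
begin

text \<open>
  Fix a vertex \<open>u\<close> and let \<open>l\<^sub>i\<close> be the number of vertices at distance \<open>i\<close> from \<open>u\<close>. A geodesic from
  \<open>u\<close> visits one vertex of each layer, so there are at most
  \<open>S = 1 + l\<^sub>1 + l\<^sub>1 l\<^sub>2 + \<dots>\<close> geodesics starting at \<open>u\<close>, where the \<open>l\<^sub>i\<close> sum to at most \<open>n - 1\<close>.
  Peeling off the first factor gives a recursion showing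
  \<open>2 S + 1 \<le> 23 \<cdot> 3\<^bsup>(n-6)/3\<^esup>\<close>, with equality at \<open>n = 6\<close>. Averaging over \<open>u\<close>
  gives the theorem, because \<open>2 gpn(G)\<close> is the sum of all \<open>S(u) + 1\<close>.
\<close>

section \<open>Sums of partial products\<close>

text \<open>The sum \<open>S\<close> of the overview when \<open>f j\<close> is the size of layer
  \<open>j + 1\<close>; the empty product at \<open>i = 0\<close> counts the trivial
  geodesic.\<close>

definition partial_prods :: "nat \<Rightarrow> (nat \<Rightarrow> nat) \<Rightarrow> nat" where
  "partial_prods k f = (\<Sum>i\<le>k. \<Prod>j<i. f j)"

lemma partial_prods_0 [simp]: "partial_prods 0 f = 1"
  by (simp add: partial_prods_def)

lemma partial_prods_Suc:
  "partial_prods (Suc k) f = 1 + f 0 * partial_prods k (\<lambda>i. f (Suc i))"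
  by (simp add: partial_prods_def sum.atMost_Suc_shift prod.lessThan_Suc_shift sum_distrib_left
      del: sum.atMost_Suc prod.lessThan_Suc)

text \<open>The table solves M(0) = 1, M(s) = max over 1 \<le> x \<le> s of 1 + x M(s - x). Its last
  entry 11, from the factors 2, 2, 1, yields the constant 23 = 2 * 11 + 1.\<close>

lemma partial_prods_small:
  assumes "(\<Sum>j<k. f j) \<le> 5"
  shows "partial_prods k f \<le> [1, 2, 3, 5, 7, 11] ! (\<Sum>j<k. f j)"
  using assms
proof (induction k arbitrary: f)
  case 0
  then show ?case by simp
next
  case (Suc k)
  define m where "m = (\<Sum>j<k. f (Suc j))"
  define P where "P = partial_prods k (\<lambda>i. f (Suc i))"
  have sum: "(\<Sum>j<Suc k. f j) = f 0 + m"
    unfolding m_def by (simp add: sum.lessThan_Suc_shift del: sum.lessThan_Suc)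
  have le: "f 0 + m \<le> 5" using Suc.prems sum by simp
  have P: "P \<le> [1, 2, 3, 5, 7, 11] ! m"
    unfolding P_def m_def by (rule Suc.IH) (use le m_def in simp)
  have "m = 0 \<or> m = 1 \<or> m = 2 \<or> m = 3 \<or> m = 4 \<or> m = 5"
    and "f 0 = 0 \<or> f 0 = 1 \<or> f 0 = 2 \<or> f 0 = 3 \<or> f 0 = 4 \<or> f 0 = 5"
    using le by linarith+
  then have "1 + f 0 * P \<le> [1, 2, 3, 5, 7, 11] ! (f 0 + m)"
    using P le by (elim disjE; simp)
  then show ?case unfolding sum partial_prods_Suc P_def .
qed

lemma cube_root_3_bounds:
  fixes c :: real
  assumes "c ^ 3 = 3"
  shows "1.4422 \<le> c" "c \<le> 1.4423"
proof -
  show "1.4422 \<le> c"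
  proof (rule power_le_imp_le_base[of _ 2])
    show "1.4422 ^ Suc 2 \<le> c ^ Suc 2" using assms by (simp add: power_divide eval_nat_numeral)
    show "0 \<le> c" using assms by (metis zero_le_odd_power odd_numeral zero_le_numeral)
  qed
  show "c \<le> 1.4423"
    by (rule power_le_imp_le_base[of _ 2]) (use assms in \<open>simp_all add: power_divide eval_nat_numeral\<close>)
qed

lemma le_cube_root_3_power:
  fixes c :: real
  assumes "c ^ 3 = 3" and "3 \<le> x"
  shows "real x \<le> c ^ x"
  using assms(2)
proof (induction x rule: dec_induct)
  case base
  then show ?case using assms(1) by simp
next
  case (step x)
  note c = cube_root_3_bounds(1)[OF assms(1)]
  have "real (Suc x) \<le> 1.4422 * real x" using step(1) by simp
  also have "\<dots> \<le> c * c ^ x" using step(3) c by (intro mult_mono) auto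
  finally show ?case by simp
qed

text \<open>With \<open>n - 1\<close> for the sum of the factors, the right-hand side below is \<open>23 \<cdot> 3\<^bsup>(n-6)/3\<^esup>\<close>. The induction step
  fails for first factors 1 and 2 when the sum is small, whence the table in
  \<open>partial_prods_small\<close>.\<close>

lemma partial_prods_bound:
  fixes c :: real
  assumes c3: "c ^ 3 = 3"
  shows "2 * real (partial_prods k f) + 1 \<le> 23 / 9 * c ^ Suc (\<Sum>j<k. f j)"
proof (induction k arbitrary: f)
  case 0
  then show ?case using cube_root_3_bounds[OF c3] by simp
next
  case (Suc k)
  note c = cube_root_3_bounds[OF c3]
  define x where "x = f 0"
  define m where "m = (\<Sum>j<k. f (Suc j))"
  define P where "P = partial_prods k (\<lambda>i. f (Suc i))"
  \<comment> \<open>\<open>T\<close> bounds the tail left after the first factor \<open>x\<close>.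
    The goal becomes \<open>2 * (1 + x * P) + 1 \<le> c ^ x * T\<close>, given
    \<open>2 * P + 1 \<le> T\<close>.\<close>
  define T where "T = 23 / 9 * c ^ Suc m"
  have sum: "(\<Sum>j<Suc k. f j) = x + m"
    unfolding m_def x_def by (simp add: sum.lessThan_Suc_shift del: sum.lessThan_Suc)
  have PS: "partial_prods (Suc k) f = 1 + x * P" by (simp add: partial_prods_Suc P_def x_def)
  have IH: "2 * real P + 1 \<le> T" unfolding P_def T_def m_def by (rule Suc.IH)
  have T: "23 / 9 * c ^ Suc (x + m) = c ^ x * T" by (simp add: T_def power_add)
  have c2: "2.079 \<le> c ^ 2" "c ^ 2 \<le> 2.081"
    using power_mono[OF c(1), of 2] power_mono[OF c(2), of 2] c by (simp_all add: power_divide)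
  have T_ge: "23 / 9 * c ^ Suc i \<le> T" if "i \<le> m" for i
    using power_increasing[of "Suc i" "Suc m" c] that c by (simp add: T_def)
  have c4: "c ^ 4 = 3 * c" and c5: "c ^ 5 = 3 * c ^ 2" and c6: "c ^ 6 = 9"
    using c3 by (simp_all add: eval_nat_numeral algebra_simps)
  show ?case
  proof (cases "x + m \<le> 5")
    case True
    define Q where "Q = 1 + x * P"
    have small: "Q \<le> [1, 2, 3, 5, 7, 11] ! (x + m)"
      using partial_prods_small[of f "Suc k"] True unfolding sum PS Q_def by blast
    consider "x + m = 0" | "x + m = 1" | "x + m = 2" | "x + m = 3" | "x + m = 4" | "x + m = 5"
      using True by linarith
    then have "2 * real Q + 1 \<le> 23 / 9 * c ^ Suc (x + m)"
    proof cases
      case 1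
      then show ?thesis using small c by simp
    next
      case 2
      have "real Q \<le> 2" using small 2 by simp
      then show ?thesis using c2 unfolding 2 by (simp add: eval_nat_numeral)
    next
      case 3
      have "real Q \<le> 3" using small 3 by simp
      then show ?thesis using c3 unfolding 3 by (simp add: eval_nat_numeral)
    next
      case 4
      have "real Q \<le> 5" using small 4 by simp
      then show ?thesis using c4 c unfolding 4 by simp
    next
      case 5
      have "real Q \<le> 7" using small 5 by simp
      then show ?thesis using c5 c2 unfolding 5 by simp
    next
      case 6
      have "real Q \<le> 11" using small 6 by simp
      then show ?thesis using c6 unfolding 6 by simp
    qed
    then show ?thesis unfolding sum PS Q_def .
  next
    case False
    consider "x = 0" | "x = 1" | "x = 2" | "3 \<le> x" by linarith
    then have "2 * real (1 + x * P) + 1 \<le> c ^ x * T"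
    proof cases
      case 1
      then show ?thesis using T_ge[of 3] False c c4 by simp
    next
      case 2
      \<comment> \<open>Here m \<ge> 5. The induction hypothesis leaves T + 2 \<le> c T to show, and
        2/5 * 23 exceeds 2.\<close>
      have "23 \<le> T" using T_ge[of 5] False 2 c6 by simp
      moreover have "7 / 5 * T \<le> c * T" using c \<open>23 \<le> T\<close> by (intro mult_right_mono) auto
      ultimately have "2 * real P + 3 \<le> c * T" using IH by linarith
      then show ?thesis using 2 by simp
    next
      case 3
      \<comment> \<open>Here m \<ge> 4. What remains is 2 T + 1 \<le> c^2 T, and 7/100 * 15 just
        exceeds 1.\<close>
      have "15 \<le> T" using T_ge[of 4] False 3 c5 c2 by simp
      moreover have "207 / 100 * T \<le> c ^ 2 * T" using c2 \<open>15 \<le> T\<close> by (intro mult_right_mono) auto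
      ultimately have "4 * real P + 3 \<le> c ^ 2 * T" using IH by linarith
      then show ?thesis using 3 by simp
    next
      case 4
      \<comment> \<open>The constants add up to 3, which is at most x.\<close>
      have "2 * real (1 + x * P) + 1 \<le> real x * (2 * real P + 1)"
        using 4 by (simp add: algebra_simps)
      also have "\<dots> \<le> c ^ x * T"
        using IH le_cube_root_3_power[OF c3 4] c by (intro mult_mono) auto
      finally show ?thesis .
    qed
    then show ?thesis unfolding sum PS T .
  qed
qed

section \<open>Geodesics starting at a vertex\<close>

lemma geodesicsD:
  assumes "p \<in> geodesics G u v"
  shows "vwalk p G" "distinct p" "p \<noteq> []" "hd p = u" "last p = v"
  using assms by (auto simp: geodesics_def paths_between_def vpath_def vwalk_def)

lemma length_vwalk_to_vpath_le: "length (vwalk_to_vpath p) \<le> length p"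
proof (induction p rule: vwalk_to_vpath_induct3)
  case (in_set x xs)
  then show ?case using length_dropWhile_le[of "\<lambda>y. y \<noteq> x" xs] by simp
qed simp_all

text \<open>Removing cycles turns a walk into a path with the same ends, so minimality among paths
  extends to walks.\<close>

lemma geodesic_length_le_vwalk:
  assumes "p \<in> geodesics G u v" and "vwalk q G" "hd q = u" "last q = v"
  shows "length p \<le> length q"
proof -
  have q: "vwalk_to_vpath q \<in> paths_between G u v"
    using assms(2-4) vwalk_to_vpath_vpath
    by (auto simp: paths_between_def vwalk_to_vpath_hd vwalk_to_vpath_last)
  then have "length p - 1 \<le> length (vwalk_to_vpath q) - 1"
    using assms(1) by (auto simp: geodesics_def)
  \<comment> \<open>Nonemptiness lets the truncated subtractions of 1 be cancelled.\<close>
  moreover have "vwalk_to_vpath q \<noteq> []"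
    using assms(2) vwalk_to_vpath_nonempty by (auto simp: vwalk_def)
  ultimately have "length p \<le> length (vwalk_to_vpath q)" by (cases "vwalk_to_vpath q") auto
  then show ?thesis using length_vwalk_to_vpath_le[of q] by linarith
qed

lemma geodesics_length_unique:
  assumes "p \<in> geodesics G u v" "q \<in> geodesics G u v"
  shows "length p = length q"
  using geodesic_length_le_vwalk[OF assms(1) geodesicsD(1,4,5)[OF assms(2)]]
    geodesic_length_le_vwalk[OF assms(2) geodesicsD(1,4,5)[OF assms(1)]] by simp

text \<open>A shorter path to \<open>last p\<close>, extended by \<open>v\<close>, would undercut
  the given geodesic.\<close>

lemma geodesics_butlast:
  assumes p: "p @ [v] \<in> geodesics G u v" and ne: "p \<noteq> []"
  shows "p \<in> geodesics G u (last p)"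
  unfolding geodesics_def
proof (intro CollectI conjI ballI)
  note pD = geodesicsD[OF p]
  have pw: "vwalk p G" using pD(1) ne vwalkI_append_l by blast
  show "p \<in> paths_between G u (last p)"
    using pw pD ne by (auto simp: paths_between_def vpath_def)
  fix q assume "q \<in> paths_between G u (last p)"
  then have q: "vwalk q G" "hd q = u" "last q = last p" "q \<noteq> []"
    by (auto simp: paths_between_def vpath_def vwalk_def)
  \<comment> \<open>Only a walk is claimed, since \<open>q\<close> may already pass through
    \<open>v\<close>.\<close>
  have "vwalk (q @ [v]) G"
    using q pD(1) ne by (auto simp: vwalk_def set_vwalk_arcs_snoc)
  then have "length (p @ [v]) \<le> length (q @ [v])"
    by (rule geodesic_length_le_vwalk[OF p]) (use q in auto)
  then show "vwalk_length p \<le> vwalk_length q" by simp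
qed

lemma geodesics_self:
  assumes "u \<in> verts G"
  shows "geodesics G u u = {[u]}"
proof -
  have "[u] \<in> geodesics G u u"
    using assms by (auto simp: geodesics_def paths_between_def vpath_self)
  moreover have "p = [u]" if "p \<in> geodesics G u u" for p
    using geodesics_length_unique[OF that \<open>[u] \<in> geodesics G u u\<close>] geodesicsD[OF that]
    by (auto simp: length_Suc_conv)
  ultimately show ?thesis by blast
qed

section \<open>Distance layers and the number of geodesics from a vertex\<close>

context graph
begin

definition geodesics_of_length :: "'a \<Rightarrow> nat \<Rightarrow> 'a list set" where
  "geodesics_of_length u i = {p. p \<in> geodesics G u (last p) \<and> length p = Suc i}"

text \<open>The vertices at distance \<open>i\<close> from \<open>u\<close>, encoded as endpoints of
  geodesics with \<open>i\<close> edges.\<close>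

definition layer :: "'a \<Rightarrow> nat \<Rightarrow> 'a set" where
  "layer u i = last ` geodesics_of_length u i"

lemma finite_vpaths: "finite {p. vpath p G}"
  by (rule finite_subset[OF _ finite_subset_distinct[OF finite_verts]])
    (auto simp: vpath_def vwalk_def)

lemma finite_geodesics_of_length: "finite (geodesics_of_length u i)"
  by (rule finite_subset[OF _ finite_vpaths])
    (auto simp: geodesics_of_length_def geodesics_def paths_between_def)

lemma layer_subset_verts: "layer u i \<subseteq> verts G"
proof
  fix v assume "v \<in> layer u i"
  then obtain p where p: "p \<in> geodesics G u v" "v = last p"
    by (auto simp: layer_def geodesics_of_length_def)
  then show "v \<in> verts G"
    using geodesicsD(1,3)[OF p(1)] by (auto simp: vwalk_def)
qed

lemma finite_layer: "finite (layer u i)"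
  by (simp add: layer_def finite_geodesics_of_length)

lemma layer_disjoint:
  assumes "i \<noteq> j"
  shows "layer u i \<inter> layer u j = {}"
proof (rule ccontr)
  assume "layer u i \<inter> layer u j \<noteq> {}"
  then obtain p q where "p \<in> geodesics_of_length u i" "q \<in> geodesics_of_length u j"
      "last p = last q"
    by (auto simp: layer_def)
  then have p: "p \<in> geodesics G u (last p)" "length p = Suc i"
    and q: "q \<in> geodesics G u (last p)" "length q = Suc j"
    by (simp_all add: geodesics_of_length_def)
  show False using geodesics_length_unique[OF p(1) q(1)] p(2) q(2) assms by simp
qed

lemma geodesics_of_length_0:
  assumes "u \<in> verts G"
  shows "geodesics_of_length u 0 = {[u]}"
proof
  show "geodesics_of_length u 0 \<subseteq> {[u]}"
  proof
    fix p assume "p \<in> geodesics_of_length u 0"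
    then have "length p = Suc 0" "hd p = u"
      by (auto simp: geodesics_of_length_def dest: geodesicsD(4))
    then show "p \<in> {[u]}" by (auto simp: length_Suc_conv)
  qed
  show "{[u]} \<subseteq> geodesics_of_length u 0"
    using geodesics_self[OF assms] by (simp add: geodesics_of_length_def)
qed

text \<open>A geodesic is determined by its last vertex and the rest, which is again a
  geodesic.\<close>

lemma card_geodesics_of_length_Suc:
  "card (geodesics_of_length u (Suc i)) \<le> card (geodesics_of_length u i) * card (layer u (Suc i))"
proof -
  let ?A = "geodesics_of_length u i \<times> layer u (Suc i)"
  have "geodesics_of_length u (Suc i) \<subseteq> (\<lambda>(p, v). p @ [v]) ` ?A"
  proof
    fix p assume p: "p \<in> geodesics_of_length u (Suc i)"
    then obtain q v where q: "p = q @ [v]" "length q = Suc i"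
      by (auto simp: geodesics_of_length_def length_Suc_conv_rev)
    then have "q \<noteq> []" by auto
    then have "q \<in> geodesics_of_length u i"
      using p q geodesics_butlast[of q v G u] by (simp add: geodesics_of_length_def)
    moreover have "v \<in> layer u (Suc i)" using p q by (force simp: layer_def)
    ultimately show "p \<in> (\<lambda>(p, v). p @ [v]) ` ?A" using q by auto
  qed
  then have "card (geodesics_of_length u (Suc i)) \<le> card ?A"
    by (rule surj_card_le[rotated]) (simp add: finite_geodesics_of_length finite_layer)
  then show ?thesis by (simp add: card_cartesian_product)
qed

lemma card_geodesics_of_length:
  assumes "u \<in> verts G"
  shows "card (geodesics_of_length u i) \<le> (\<Prod>j<i. card (layer u (Suc j)))"
proof (induction i)
  case 0
  then show ?case using geodesics_of_length_0[OF assms] by simp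
next
  case (Suc i)
  then show ?case
    using card_geodesics_of_length_Suc[of u i] by (simp add: order_trans[OF _ mult_right_mono])
qed

text \<open>The layers are disjoint, and \<open>Suc\<close> accounts for \<open>u\<close>, which
  lies in layer 0.\<close>

lemma sum_card_layers:
  assumes "u \<in> verts G"
  shows "Suc (\<Sum>j<k. card (layer u (Suc j))) \<le> card (verts G)"
proof -
  have "(\<Sum>j<k. card (layer u (Suc j))) = card (\<Union>j<k. layer u (Suc j))"
    using layer_disjoint by (intro card_UN_disjoint[symmetric]) (auto simp: finite_layer)
  also have "\<dots> \<le> card (verts G - {u})"
  proof (intro card_mono)
    have "u \<notin> layer u (Suc j)" for j
      using layer_disjoint[of 0 "Suc j" u] geodesics_of_length_0[OF assms]
      by (auto simp: layer_def)
    then show "(\<Union>j<k. layer u (Suc j)) \<subseteq> verts G - {u}" using layer_subset_verts by fastforce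
  qed simp
  also have "\<dots> = card (verts G) - 1" using assms by simp
  finally show ?thesis
    using assms card_gt_0_iff[of "verts G"] by fastforce
qed

text \<open>Geodesics from \<open>u\<close> are regrouped from endpoint to length. Distinctness of
  their vertices caps the length.\<close>

lemma sum_gpn_between_le:
  assumes u: "u \<in> verts G"
  shows "(\<Sum>v\<in>verts G. gpn_between G u v) \<le>
    partial_prods (card (verts G)) (\<lambda>j. card (layer u (Suc j)))"
proof -
  let ?n = "card (verts G)"
  have fin: "finite (geodesics G u v)" for v
    by (rule finite_subset[OF _ finite_vpaths]) (auto simp: geodesics_def paths_between_def)
  have "(\<Sum>v\<in>verts G. gpn_between G u v) = card (\<Union>v\<in>verts G. geodesics G u v)"
    unfolding gpn_between_def
  proof (intro card_UN_disjoint[symmetric] ballI impI)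
    fix v w :: 'a assume "v \<noteq> w"
    then show "geodesics G u v \<inter> geodesics G u w = {}" by (blast dest: geodesicsD(5))
  qed (simp_all add: fin)
  also have "\<dots> \<le> card (\<Union>i\<le>?n. geodesics_of_length u i)"
  proof (intro card_mono)
    show "(\<Union>v\<in>verts G. geodesics G u v) \<subseteq> (\<Union>i\<le>?n. geodesics_of_length u i)"
    proof
      fix p assume "p \<in> (\<Union>v\<in>verts G. geodesics G u v)"
      then obtain v where p: "p \<in> geodesics G u v" by blast
      note pD = geodesicsD[OF p]
      have "length p = card (set p)" using pD by (simp add: distinct_card)
      also have "\<dots> \<le> ?n" using pD(1) by (intro card_mono) (auto simp: vwalk_def)
      finally have "length p - 1 \<le> ?n" by simp
      moreover have "p \<in> geodesics_of_length u (length p - 1)"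
        using p pD by (auto simp: geodesics_of_length_def)
      ultimately show "p \<in> (\<Union>i\<le>?n. geodesics_of_length u i)" by blast
    qed
  qed (simp add: finite_geodesics_of_length)
  also have "\<dots> \<le> (\<Sum>i\<le>?n. card (geodesics_of_length u i))" by (rule card_UN_le) simp
  also have "\<dots> \<le> partial_prods ?n (\<lambda>j. card (layer u (Suc j)))"
    unfolding partial_prods_def by (intro sum_mono card_geodesics_of_length[OF u])
  finally show ?thesis .
qed

lemma sum_gpn_between_bound:
  fixes c :: real
  assumes c: "c ^ 3 = 3" and u: "u \<in> verts G"
  shows "2 * real (\<Sum>v\<in>verts G. gpn_between G u v) + 1 \<le> 23 / 9 * c ^ card (verts G)"
proof -
  let ?n = "card (verts G)" and ?f = "\<lambda>j. card (layer u (Suc j))"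
  have "2 * real (\<Sum>v\<in>verts G. gpn_between G u v) + 1 \<le> 2 * real (partial_prods ?n ?f) + 1"
    using sum_gpn_between_le[OF u] by (simp del: of_nat_sum)
  also have "\<dots> \<le> 23 / 9 * c ^ Suc (\<Sum>j<?n. ?f j)" by (rule partial_prods_bound[OF c])
  also have "\<dots> \<le> 23 / 9 * c ^ ?n"
    using sum_card_layers[OF u] cube_root_3_bounds(1)[OF c]
    by (intro mult_left_mono power_increasing) auto
  finally show ?thesis .
qed

section \<open>From ordered to unordered pairs\<close>

text \<open>The fibre of ordered pairs over each edge set \<open>{a, b}\<close> has two elements, of
  equal value by symmetry.\<close>

lemma sum_ordered_gpn_between:
  "(\<Sum>u\<in>verts G. \<Sum>v\<in>verts G - {u}. gpn_between G u v) =
    2 * (\<Sum>e | e \<subseteq> verts G \<and> card e = 2. gpn_pair G e)"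
proof -
  let ?V = "verts G" and ?E = "{e. e \<subseteq> verts G \<and> card e = 2}"
  let ?S = "SIGMA u:?V. ?V - {u}"
  let ?g = "\<lambda>x. gpn_between G (fst x) (snd x)" and ?h = "\<lambda>x. {fst x, snd x}"
  have "(\<Sum>u\<in>?V. \<Sum>v\<in>?V - {u}. gpn_between G u v) = (\<Sum>x\<in>?S. ?g x)"
    by (simp add: sum.Sigma case_prod_beta)
  also have "\<dots> = (\<Sum>e\<in>?E. \<Sum>x\<in>{x \<in> ?S. ?h x = e}. ?g x)"
  proof (rule sum.group[symmetric])
    show "?h ` ?S \<subseteq> ?E" by (auto simp: card_insert_if)
  qed simp_all
  also have "\<dots> = (\<Sum>e\<in>?E. 2 * gpn_pair G e)"
  proof (rule sum.cong[OF refl])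
    fix e assume "e \<in> ?E"
    then obtain a b where e: "e = {a, b}" "a \<noteq> b" "a \<in> ?V" "b \<in> ?V"
      by (auto simp: card_2_iff)
    then have "{x \<in> ?S. ?h x = e} = {(a, b), (b, a)}" by (auto simp: doubleton_eq_iff)
    then show "(\<Sum>x\<in>{x \<in> ?S. ?h x = e}. ?g x) = 2 * gpn_pair G e"
      using e by (simp add: gpn_pair_eq gpn_between_commute[of b a])
  qed
  finally show ?thesis by (simp add: sum_distrib_left)
qed

lemma double_gpn: "2 * gpn G = (\<Sum>u\<in>verts G. (\<Sum>v\<in>verts G. gpn_between G u v) + 1)"
proof -
  \<comment> \<open>The extra 1 is the trivial geodesic \<open>[u]\<close>. Together with the 1 in
    the statement it gives twice the term \<open>card (verts G)\<close> of
    \<open>gpn\<close>.\<close>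
  have "(\<Sum>v\<in>verts G. gpn_between G u v) = (\<Sum>v\<in>verts G - {u}. gpn_between G u v) + 1"
    if "u \<in> verts G" for u
    using geodesics_self[OF that] sum.remove[OF finite_verts that, of "gpn_between G u"]
    by (simp add: gpn_between_def)
  then have "(\<Sum>u\<in>verts G. (\<Sum>v\<in>verts G. gpn_between G u v) + 1)
      = (\<Sum>u\<in>verts G. (\<Sum>v\<in>verts G - {u}. gpn_between G u v) + 2)"
    by (intro sum.cong) auto
  also have "\<dots> = 2 * gpn G"
    unfolding sum.distrib sum_ordered_gpn_between gpn_def by simp
  finally show ?thesis ..
qed

end

theorem theorem2:
  fixes G :: "('a, 'b) pre_digraph" and n :: nat
  assumes "graph G"
    and "Digraph_Component.connected G"
    and "n = card (verts G)"
    and "n \<ge> 1"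
  shows "real (gpn G) \<le> real n / 4 * (23 * 3 powr ((real n - 6) / 3) + 1)"
proof -
  interpret graph G by (rule assms(1))
  \<comment> \<open>With the cube root as base, the real exponent (n - 6)/3 becomes the natural
    exponent \<open>n\<close> and a factor 1/9.\<close>
  define c :: real where "c = 3 powr (1 / 3)"
  have c: "c ^ 3 = 3" by (simp add: c_def powr_power)
  have "3 powr ((real n - 6) / 3) = 3 powr (real n / 3) / (3 powr 2 :: real)"
    by (simp only: powr_diff diff_divide_distrib, simp)
  also have "\<dots> = c ^ n / 9" by (simp add: c_def powr_power)
  finally have powr: "3 powr ((real n - 6) / 3) = c ^ n / 9" .
  have "4 * real (gpn G) = 2 * real (2 * gpn G)" by simp
  also have "\<dots> = (\<Sum>u\<in>verts G. 2 * real (\<Sum>v\<in>verts G. gpn_between G u v) + 2)"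
    unfolding double_gpn by (simp add: sum_distrib_left algebra_simps)
  also have "\<dots> \<le> (\<Sum>u\<in>verts G. 23 / 9 * c ^ n + 1)"
    by (rule sum_mono) (use sum_gpn_between_bound[OF c] assms(3) in force)
  also have "\<dots> = real n * (23 / 9 * c ^ n + 1)" using assms(3) by simp
  finally show ?thesis unfolding powr by simp
qed

end
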